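(* Let $F,G\subseteq\mathbb{R}^d\times\mathbb{R}^d\times\mathbb{R}^d\times\mathbb{S}^{3d\times 3d}$ be defined by $$ F=\left\{(y,x,l,M)\;\middle|\; y=\max\{x,l\},\; M=\begin{bmatrix}y\\ x\\ l\end{bmatrix}\begin{bmatrix}y\\ x\\ l\end{bmatrix}^T\right\}, $$ $$ G=\left\{(y,x,l,M)\;\middle|\; \begin{array}{l} y\ge x,\quad y\ge l,\\ \operatorname{tr}\left(\begin{bmatrix} I & -I/2 & -I/2\\ -I/2 & 0 & I/2\\ -I/2 & I/2 & 0\end{bmatrix}M\right)=0,\\ \begin{bmatrix}M & \begin{bmatrix}y\\ x\\ l\end{bmatrix}\\ \begin{bmatrix}y^T & x^T & l^T\end{bmatrix} & 1\end{bmatrix}\succeq 0 \end{array}\right\}. $$ Then $F\subseteq G$.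
   Context: $\mathbb{S}^{m\times m}$ denotes the set of real symmetric $m\times m$ matrices, $I$ is the $d\times d$ identity matrix, and $\succeq 0$ means positive semidefinite. The maximum $\max\{x,l\}$ of two vectors and the vector inequalities $\ge$ are taken component-wise. *)

theory Defs
  imports "HOL-Analysis.Analysis"
begin

text \<open>
  The dimension $d$ is \<open>CARD('n)\<close>. Stacked objects are indexed by sum types: vectors in
  $\mathbb{R}^{3d}$ by \<open>'n + 'n + 'n\<close> (that is, \<open>'n + ('n + 'n)\<close>), and the
  bordered matrix of size $3d+1$ by \<open>('n + 'n + 'n) + 1\<close>, where \<open>1\<close> is the one-element
  index type. In \<open>real ^ 'c ^ 'r\<close>, \<open>'r\<close> indexes rows and \<open>'c\<close> columns.
\<close>

text \<open>
  The library's \<open>columnvector v\<close> is polymorphic in the number of (equal) columns; here it is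
  pinned to a single column, so that matrix products with it are not scaled.
\<close>

abbreviation col_mat :: "real ^ 'm \<Rightarrow> real ^ 1 ^ 'm" where
  "col_mat \<equiv> columnvector"

definition stack3 :: "real ^ 'n \<Rightarrow> real ^ 'n \<Rightarrow> real ^ 'n \<Rightarrow> real ^ ('n + 'n + 'n)" where
  "stack3 y x l =
     (\<chi> k. case k of Inl i \<Rightarrow> y $ i | Inr (Inl i) \<Rightarrow> x $ i | Inr (Inr i) \<Rightarrow> l $ i)"

definition block2 ::
  "real ^ 'c ^ 'a \<Rightarrow> real ^ 'd ^ 'a \<Rightarrow>
   real ^ 'c ^ 'b \<Rightarrow> real ^ 'd ^ 'b \<Rightarrow> real ^ ('c + 'd) ^ ('a + 'b)" where
  "block2 A B C D =
     (\<chi> r c. case r of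
        Inl i \<Rightarrow> (case c of Inl j \<Rightarrow> A $ i $ j | Inr j \<Rightarrow> B $ i $ j)
      | Inr i \<Rightarrow> (case c of Inl j \<Rightarrow> C $ i $ j | Inr j \<Rightarrow> D $ i $ j))"

definition block3 ::
  "real ^ 'n ^ 'n \<Rightarrow> real ^ 'n ^ 'n \<Rightarrow> real ^ 'n ^ 'n \<Rightarrow>
   real ^ 'n ^ 'n \<Rightarrow> real ^ 'n ^ 'n \<Rightarrow> real ^ 'n ^ 'n \<Rightarrow>
   real ^ 'n ^ 'n \<Rightarrow> real ^ 'n ^ 'n \<Rightarrow> real ^ 'n ^ 'n \<Rightarrow>
   real ^ ('n + 'n + 'n) ^ ('n + 'n + 'n)" where
  "block3 A11 A12 A13 A21 A22 A23 A31 A32 A33 =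
     (\<chi> r c. case r of
        Inl i \<Rightarrow>
          (case c of Inl j \<Rightarrow> A11 $ i $ j | Inr (Inl j) \<Rightarrow> A12 $ i $ j | Inr (Inr j) \<Rightarrow> A13 $ i $ j)
      | Inr (Inl i) \<Rightarrow>
          (case c of Inl j \<Rightarrow> A21 $ i $ j | Inr (Inl j) \<Rightarrow> A22 $ i $ j | Inr (Inr j) \<Rightarrow> A23 $ i $ j)
      | Inr (Inr i) \<Rightarrow>
          (case c of Inl j \<Rightarrow> A31 $ i $ j | Inr (Inl j) \<Rightarrow> A32 $ i $ j | Inr (Inr j) \<Rightarrow> A33 $ i $ j))"

definition sym_mats :: "(real ^ 'm ^ 'm) set" where
  "sym_mats = {A. transpose A = A}"

definition psd :: "real ^ 'm ^ 'm \<Rightarrow> bool" where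
  "psd A \<longleftrightarrow> A \<in> sym_mats \<and> (\<forall>v. 0 \<le> v \<bullet> (A *v v))"

text \<open>
  \<open>max\<close> on \<open>real ^ 'n\<close> is not the component-wise maximum, since the order there is only partial.
\<close>

definition cmax :: "real ^ 'n \<Rightarrow> real ^ 'n \<Rightarrow> real ^ 'n" where
  "cmax x l = (\<chi> i. max (x $ i) (l $ i))"

definition Q :: "real ^ ('n::finite + 'n + 'n) ^ ('n + 'n + 'n)" where
  "Q = (let I = mat 1; H = (1/2) *\<^sub>R mat 1 in
     block3   I  (-H)  (-H)
            (-H)   0     H
            (-H)   H     0)"

definition F ::
  "((real ^ 'n) \<times> (real ^ 'n) \<times> (real ^ 'n) \<times>
    (real ^ ('n + 'n + 'n) ^ ('n + 'n + 'n))) set" where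
  "F = {(y, x, l, M). M \<in> sym_mats \<and>
     y = cmax x l \<and>
     M = col_mat (stack3 y x l) ** transpose (col_mat (stack3 y x l))}"

text \<open>The order \<open>\<le>\<close> on \<open>real ^ 'n\<close> is component-wise.\<close>

definition G ::
  "((real ^ 'n) \<times> (real ^ 'n) \<times> (real ^ 'n) \<times>
    (real ^ ('n + 'n + 'n) ^ ('n + 'n + 'n))) set" where
  "G = {(y, x, l, M). M \<in> sym_mats \<and>
     y \<ge> x \<and> y \<ge> l \<and>
     trace (Q ** M) = 0 \<and>
     psd (block2 M (col_mat (stack3 y x l)) (transpose (col_mat (stack3 y x l))) (mat 1))}"

end

theory Submission
  imports Defs
begin

text \<open>
  Write \<open>u\<close> for the stacked vector of \<open>y\<close>, \<open>x\<close> and \<open>l\<close>. On \<open>F\<close> the matrix \<open>M\<close> is the rank-one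
  matrix \<open>u u\<^sup>T\<close>, and each constraint of \<open>G\<close> becomes a statement about \<open>u\<close> alone.

  The trace of \<open>Q u u\<^sup>T\<close> is the quadratic form \<open>u \<bullet> Q u\<close>, and \<open>Q\<close> is the symmetric matrix for which
  this form is \<open>(y - x) \<bullet> (y - l)\<close> (lemma \<open>quadratic_form_Q\<close>). It vanishes because in every
  coordinate the maximum equals one of its two arguments, so one of the two factors is zero.

  The bordered matrix is again of rank one: it is \<open>w w\<^sup>T\<close> where \<open>w\<close> is \<open>u\<close> extended by an entry \<open>1\<close>
  (lemma \<open>block2_outer\<close>), hence positive semidefinite, since \<open>v \<bullet> w w\<^sup>T v = (w \<bullet> v)\<^sup>2\<close>.
\<close>

abbreviation outer :: "real ^ 'm \<Rightarrow> real ^ 'm ^ 'm" where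
  "outer u \<equiv> col_mat u ** transpose (col_mat u)"

lemma outer_nth: "outer u $ i $ j = u $ i * u $ j"
  by (simp add: matrix_matrix_mult_def columnvector_def transpose_def)

lemma outer_mult_vec: "outer u *v v = (u \<bullet> v) *\<^sub>R u"
  by (simp add: vec_eq_iff matrix_vector_mult_def outer_nth inner_vec_def sum_distrib_left
      mult.commute mult.left_commute)

lemma psd_outer: "psd (outer u)"
  unfolding psd_def sym_mats_def
  by (simp add: outer_mult_vec inner_commute[of _ u] matrix_transpose_mul)

lemma trace_mult_outer: "trace (A ** outer u) = u \<bullet> (A *v u)"
proof -
  have "(A ** outer u) $ i $ i = u $ i * (A *v u) $ i" for i
    by (simp add: matrix_matrix_mult_def[of A] matrix_vector_mult_def outer_nth
        sum_distrib_left mult.commute mult.left_commute)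
  then show ?thesis
    by (simp add: trace_def inner_vec_def)
qed

lemma block2_outer:
  fixes u :: "real ^ 'm"
  shows "block2 (outer u) (col_mat u) (transpose (col_mat u)) (mat 1 :: real ^ 1 ^ 1)
    = outer (\<chi> k. case k of Inl i \<Rightarrow> u $ i | Inr _ \<Rightarrow> 1)"
  by (simp add: vec_eq_iff block2_def outer_nth split: sum.split)
    (simp add: columnvector_def transpose_def mat_def)

lemma sum_UNIV_sum_type:
  fixes f :: "'a::finite + 'b::finite \<Rightarrow> 'c::comm_monoid_add"
  shows "(\<Sum>k\<in>UNIV. f k) = (\<Sum>i\<in>UNIV. f (Inl i)) + (\<Sum>j\<in>UNIV. f (Inr j))"
  by (simp add: UNIV_Plus_UNIV[symmetric] sum.Plus del: UNIV_Plus_UNIV)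

lemma inner_stack3: "stack3 a b c \<bullet> stack3 y x l = a \<bullet> y + b \<bullet> x + c \<bullet> l"
  by (simp add: inner_vec_def stack3_def sum_UNIV_sum_type add.assoc)

lemma block3_mult_stack3:
  "block3 A11 A12 A13 A21 A22 A23 A31 A32 A33 *v stack3 y x l =
     stack3 (A11 *v y + A12 *v x + A13 *v l)
            (A21 *v y + A22 *v x + A23 *v l)
            (A31 *v y + A32 *v x + A33 *v l)"
  by (simp add: vec_eq_iff matrix_vector_mult_def block3_def stack3_def sum_UNIV_sum_type
      add.assoc split: sum.split)

lemma uminus_matrix_vector_mult: "(- A) *v (v :: real ^ 'm) = - (A *v v)"
  by (simp add: vec_eq_iff matrix_vector_mult_def sum_negf)

text \<open>
  The form expands to \<open>y \<bullet> y - y \<bullet> x - y \<bullet> l + x \<bullet> l\<close>: each off-diagonal entry of \<open>Q\<close> carries half of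
  a mixed term, which symmetry doubles.
\<close>

lemma quadratic_form_Q: "stack3 y x l \<bullet> (Q *v stack3 y x l) = (y - x) \<bullet> (y - l)"
proof -
  have "Q *v stack3 y x l =
      stack3 (y - (1/2) *\<^sub>R x - (1/2) *\<^sub>R l)
             ((1/2) *\<^sub>R l - (1/2) *\<^sub>R y)
             ((1/2) *\<^sub>R x - (1/2) *\<^sub>R y)"
    by (simp add: Q_def Let_def block3_mult_stack3 uminus_matrix_vector_mult
        scaleR_matrix_vector_assoc[symmetric])
  then show ?thesis
    by (simp add: inner_stack3 inner_diff_left inner_diff_right inner_commute)
qed

lemma cmax_complementary: "(cmax x l - x) \<bullet> (cmax x l - l) = 0"
  unfolding inner_vec_def by (rule sum.neutral) (simp add: cmax_def max_def)

theorem proposition4p3: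
  shows "(F :: ((real ^ 'n) \<times> (real ^ 'n) \<times> (real ^ 'n) \<times>
            (real ^ ('n + 'n + 'n) ^ ('n + 'n + 'n))) set) \<subseteq> G"
proof -
  have "(y, x, l, M) \<in> G" if "(y, x, l, M) \<in> F"
    for y x l :: "real ^ 'n" and M :: "real ^ ('n + 'n + 'n) ^ ('n + 'n + 'n)"
  proof -
    have sym: "M \<in> sym_mats" and y: "y = cmax x l" and M: "M = outer (stack3 y x l)"
      using that by (auto simp: F_def)
    have "x \<le> y" "l \<le> y"
      by (simp_all add: y cmax_def less_eq_vec_def)
    moreover have "trace (Q ** M) = 0"
      by (simp only: M trace_mult_outer quadratic_form_Q y cmax_complementary)
    moreover have "psd (block2 M (col_mat (stack3 y x l)) (transpose (col_mat (stack3 y x l))) (mat 1))"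
      by (simp only: M block2_outer psd_outer)
    ultimately show ?thesis
      using sym by (simp add: G_def)
  qed
  then show ?thesis
    by auto
qed

end
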